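(* Let $\{\widehat{\alpha}_h\}_{h\in H}$ be a uniformly expanding family of automorphisms of $\widehat{G}$, with upper Lipschitz constants $L(h)$ and associated monotone increasing function $f:\mathbb{R}^+\to\mathbb{R}^+$. Suppose that there exists $M>0$ such that, for all $c>1$, $$u_c(t)=\varsigma\big(\{h\in H: t\le L(h)\le f(ct)\}\big)\in L^\infty\big([M,+\infty)\big).$$ Then for every $\psi\in L^2(G)$ there is $M'>0$ such that $$\Psi_{M'}(\xi)=\int_{\{h\in H:\,L(h)>M'\}}|\widehat{D}(h)\widehat{\psi}(\xi)|^2\,d\varsigma(h)\ \in\ L^1_{\mathrm{loc}}\big(\widehat{G}\setminus\{\mathrm{e}\}\big).$$
   Context: $G$ is a locally compact second countable abelian group with a fixed Haar measure $\mu_G$; $\widehat{G}$ is its dual group with identity $\mathrm{e}$ and pairing $\langle\xi,x\rangle\in\mathbb{T}$; $\widehat{f}(\xi)=\int_G f(x)\overline{\langle\xi,x\rangle}\,d\mu_G(x)$; $\nu_{\widehat{G}}$ is the Haar measure on $\widehat{G}$ making the Fourier transform unitary from $L^2(G)$ to $L^2(\widehat{G})$. $\widehat{G}$ carries a translation-invariant metric $d_{\widehat{G}}$ inducing its topology, whose closed balls are compact, with open balls $B(\xi_0,r)$, and which is weakly doubling: there are $r_0>0$, $C>0$ with $\nu_{\widehat{G}}(B(\mathrm{e},2r))\le C\,\nu_{\widehat{G}}(B(\mathrm{e},r))$ for all $r<r_0$. $\varsigma$ is a $\sigma$-finite Borel measure on $H$, and $\alpha:H\to\mathrm{Aut}(G)$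 is such that $(x,h)\mapsto\alpha_h(x)$ is measurable on $(G,\mu_G)\times(H,\varsigma)$. $\delta:H\to\mathbb{R}^+$ is the measurable function with $\int_G g(\alpha_h(x))\,d\mu_G(x)=\delta(h)\int_G g\,d\mu_G$ for $g\in L^1(G)$. The dual automorphism $\widehat{\alpha}_h\in\mathrm{Aut}(\widehat{G})$ is defined by $\langle\widehat{\alpha}_h(\xi),x\rangle=\langle\xi,\alpha_h^{-1}(x)\rangle$, and $\widehat{D}(h)\widehat\psi(\xi)=\delta(h)^{1/2}\widehat\psi(\widehat{\alpha}_h(\xi))$. The family $\{\widehat{\alpha}_h\}$ is measurably bi-Lipschitz with constants $\ell,L$ if $\ell,L:H\to\mathbb{R}^+$ are $\varsigma$-measurable and $\ell(h)d_{\widehat{G}}(\xi,\mathrm{e})\le d_{\widehat{G}}(\widehat{\alpha}_h(\xi),\mathrm{e})\le L(h)d_{\widehat{G}}(\xi,\mathrm{e})$ for all $\xi\in\widehat{G}$, $h\in H$. A measurably bi-Lipschitz family with constants $\ell,L$ is uniformly expanding (with associated function $f$) if there exist $M>0$ and a monotone increasing function $f:\mathbb{R}^+\to\mathbb{R}^+$ such that for all $h\in H$: $L(h)>M\Rightarrow L(h)\le f(\ell(h))$. A nonnegative measurable $F$ on $\widehat{G}$ is in $L^1_{\mathrm{loc}}(S)$, $S\subset\widehat{G}$, if every $\xi_0\in S$ has some $\epsilon>0$ with $\int_{B(\xi_0,\epsilon)}F\,d\nu_{\widehat{G}}<\infty$. *)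

theory Defs
  imports "HOL-Probability.Essential_Supremum"
begin

text \<open>The group operation on characters is pointwise multiplication; it is written additively
  so that the library's class of abelian groups applies. The identity e is \<open>0\<close>.\<close>

typedef (overloaded) ('g::topological_ab_group_add) pontryagin_dual =
  "{\<kappa>. continuous_on UNIV \<kappa> \<and>
      (\<forall>x. norm (\<kappa> x) = 1) \<and> (\<forall>x y. \<kappa> (x + y) = \<kappa> x * \<kappa> y)} :: ('g \<Rightarrow> complex) set"
  morphisms pairing Abs_dual
  by (rule exI[of _ "\<lambda>_. 1"]) simp

setup_lifting type_definition_pontryagin_dual

instantiation pontryagin_dual :: (topological_ab_group_add) ab_group_add
begin

lift_definition zero_pontryagin_dual :: "'a pontryagin_dual" is "\<lambda>_. 1"
  by simp

lift_definition plus_pontryagin_dual ::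
  "'a pontryagin_dual \<Rightarrow> 'a pontryagin_dual \<Rightarrow> 'a pontryagin_dual" is "\<lambda>\<kappa> \<eta> x. \<kappa> x * \<eta> x"
  by (auto intro!: continuous_intros simp: norm_mult)

lift_definition uminus_pontryagin_dual ::
  "'a pontryagin_dual \<Rightarrow> 'a pontryagin_dual" is "\<lambda>\<kappa> x. cnj (\<kappa> x)"
  by (auto intro!: continuous_intros)

definition minus_pontryagin_dual ::
  "'a pontryagin_dual \<Rightarrow> 'a pontryagin_dual \<Rightarrow> 'a pontryagin_dual" where
  "minus_pontryagin_dual \<kappa> \<eta> = \<kappa> + - \<eta>"

instance
proof
  fix a b c :: "'a pontryagin_dual"
  show "a + b + c = a + (b + c)" by transfer (simp add: mult.assoc)
  show "a + b = b + a" by transfer (simp add: mult.commute)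
  show "0 + a = a" by transfer simp
  show "- a + a = 0"
  proof transfer
    fix \<kappa> :: "'a \<Rightarrow> complex"
    assume "continuous_on UNIV \<kappa> \<and> (\<forall>x. norm (\<kappa> x) = 1) \<and> (\<forall>x y. \<kappa> (x + y) = \<kappa> x * \<kappa> y)"
    then show "(\<lambda>x. cnj (\<kappa> x) * \<kappa> x) = (\<lambda>_. 1)"
      by (auto simp: fun_eq_iff mult.commute[of "cnj _"] complex_norm_square[symmetric])
  qed
  show "a - b = a + - b" by (rule minus_pontryagin_dual_def)
qed

end

instantiation pontryagin_dual :: (topological_ab_group_add) topological_space
begin

definition open_pontryagin_dual :: "'a pontryagin_dual set \<Rightarrow> bool" where
  "open_pontryagin_dual =
     generate_topology {{\<xi>. pairing \<xi> ` K \<subseteq> V} | K V. compact K \<and> open V}"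

instance
proof
  show "open (UNIV :: 'a pontryagin_dual set)"
    unfolding open_pontryagin_dual_def by (rule generate_topology.UNIV)
qed (auto simp: open_pontryagin_dual_def intro: generate_topology.Int generate_topology.UN)

end

text \<open>Both groups under consideration are second countable, locally compact and Hausdorff;
  on such a group a Borel measure that is finite on compact sets is automatically regular,
  so regularity is not listed.\<close>

definition haar_measure :: "'a::{topological_space, ab_group_add} measure \<Rightarrow> bool" where
  "haar_measure \<mu> \<longleftrightarrow>
     sets \<mu> = sets borel \<and>
     emeasure \<mu> UNIV \<noteq> 0 \<and>
     (\<forall>K. compact K \<longrightarrow> emeasure \<mu> K < \<infinity>) \<and>
     (\<forall>a. \<forall>A \<in> sets borel. emeasure \<mu> ((+) a ` A) = emeasure \<mu> A)"

definition square_integrable :: "'a measure \<Rightarrow> ('a \<Rightarrow> complex) \<Rightarrow> bool" where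
  "square_integrable M f \<longleftrightarrow> f \<in> borel_measurable M \<and> integrable M (\<lambda>x. (norm (f x))\<^sup>2)"

definition fourier ::
  "'g::topological_ab_group_add measure \<Rightarrow> ('g \<Rightarrow> complex) \<Rightarrow> 'g pontryagin_dual \<Rightarrow> complex" where
  "fourier \<mu> f \<xi> = (LINT x|\<mu>. f x * cnj (pairing \<xi> x))"

text \<open>\<open>fourier_L2 \<mu> \<nu> \<psi> F\<close> says that \<open>F\<close> is a representative of the
  Fourier transform of \<open>\<psi> \<in> L\<^sup>2(\<mu>)\<close>, the transform being extended by \<open>L\<^sup>2\<close>-limits from
  \<open>L\<^sup>1 \<inter> L\<^sup>2\<close>. It is a relation because \<open>F\<close> is determined only up to null sets.\<close>

definition fourier_L2 ::
  "'g::topological_ab_group_add measure \<Rightarrow> 'g pontryagin_dual measure \<Rightarrow>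
   ('g \<Rightarrow> complex) \<Rightarrow> ('g pontryagin_dual \<Rightarrow> complex) \<Rightarrow> bool" where
  "fourier_L2 \<mu> \<nu> \<psi> F \<longleftrightarrow>
     square_integrable \<mu> \<psi> \<and> square_integrable \<nu> F \<and>
     (\<exists>g :: nat \<Rightarrow> 'g \<Rightarrow> complex.
        (\<forall>n. integrable \<mu> (g n) \<and> square_integrable \<mu> (g n)) \<and>
        (\<lambda>n. \<integral>\<^sup>+ x. ennreal ((norm (g n x - \<psi> x))\<^sup>2) \<partial>\<mu>) \<longlonglongrightarrow> 0 \<and>
        (\<lambda>n. \<integral>\<^sup>+ \<xi>. ennreal ((norm (fourier \<mu> (g n) \<xi> - F \<xi>))\<^sup>2) \<partial>\<nu>) \<longlonglongrightarrow> 0)"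

text \<open>\<open>\<nu>\<close> is the Haar measure on the dual for which the Fourier transform is unitary from
  \<open>L\<^sup>2(\<mu>)\<close> to \<open>L\<^sup>2(\<nu>)\<close>: isometric on the dense subspace \<open>L\<^sup>1 \<inter> L\<^sup>2\<close>, with an extension
  that is everywhere defined and onto.\<close>

definition plancherel_measure ::
  "'g::topological_ab_group_add measure \<Rightarrow> 'g pontryagin_dual measure \<Rightarrow> bool" where
  "plancherel_measure \<mu> \<nu> \<longleftrightarrow>
     haar_measure \<nu> \<and>
     (\<forall>g. integrable \<mu> g \<and> square_integrable \<mu> g \<longrightarrow>
        square_integrable \<nu> (fourier \<mu> g) \<and>
        (LINT \<xi>|\<nu>. (norm (fourier \<mu> g \<xi>))\<^sup>2) = (LINT x|\<mu>. (norm (g x))\<^sup>2)) \<and>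
     (\<forall>\<psi>. square_integrable \<mu> \<psi> \<longrightarrow> (\<exists>F. fourier_L2 \<mu> \<nu> \<psi> F)) \<and>
     (\<forall>F. square_integrable \<nu> F \<longrightarrow> (\<exists>\<psi>. fourier_L2 \<mu> \<nu> \<psi> F))"

definition is_automorphism :: "('a::topological_ab_group_add \<Rightarrow> 'a) \<Rightarrow> bool" where
  "is_automorphism \<phi> \<longleftrightarrow>
     (\<forall>x y. \<phi> (x + y) = \<phi> x + \<phi> y) \<and> bij \<phi> \<and>
     continuous_on UNIV \<phi> \<and> continuous_on UNIV (inv \<phi>)"

definition dual_automorphism ::
  "('g::topological_ab_group_add \<Rightarrow> 'g) \<Rightarrow> 'g pontryagin_dual \<Rightarrow> 'g pontryagin_dual" where
  "dual_automorphism \<phi> \<xi> = Abs_dual (\<lambda>x. pairing \<xi> (inv \<phi> x))"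

lemma pairing_dual_automorphism:
  assumes "is_automorphism \<phi>"
  shows "pairing (dual_automorphism \<phi> \<xi>) x = pairing \<xi> (inv \<phi> x)"
proof -
  have \<phi>: "\<phi> (x + y) = \<phi> x + \<phi> y" "bij \<phi>" "continuous_on UNIV (inv \<phi>)" for x y
    using assms by (auto simp: is_automorphism_def)
  have "inv \<phi> (x + y) = inv \<phi> x + inv \<phi> y" for x y
    by (rule inv_f_eq) (simp_all add: \<phi>(1) bij_is_inj[OF \<phi>(2)] surj_f_inv_f[OF bij_is_surj[OF \<phi>(2)]])
  moreover have "continuous_on UNIV (pairing \<xi>)" "norm (pairing \<xi> x) = 1"
    "pairing \<xi> (x + y) = pairing \<xi> x * pairing \<xi> y" for x y
    using pairing[of \<xi>] by simp_all
  moreover from this(1) have "continuous_on UNIV (\<lambda>x. pairing \<xi> (inv \<phi> x))"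
    by (rule continuous_on_compose2[OF _ \<phi>(3)]) simp
  ultimately have "(\<lambda>x. pairing \<xi> (inv \<phi> x)) \<in>
    {\<kappa>. continuous_on UNIV \<kappa> \<and> (\<forall>x. norm (\<kappa> x) = 1) \<and> (\<forall>x y. \<kappa> (x + y) = \<kappa> x * \<kappa> y)}"
    by simp
  then show ?thesis
    unfolding dual_automorphism_def by (simp add: Abs_dual_inverse)
qed

definition modulus ::
  "'g::topological_ab_group_add measure \<Rightarrow> 'h measure \<Rightarrow> ('h \<Rightarrow> 'g \<Rightarrow> 'g) \<Rightarrow> ('h \<Rightarrow> real) \<Rightarrow> bool" where
  "modulus \<mu> \<sigma> \<alpha> \<delta> \<longleftrightarrow>
     \<delta> \<in> borel_measurable \<sigma> \<and> (\<forall>h. \<delta> h > 0) \<and>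
     (\<forall>h. \<forall>g :: 'g \<Rightarrow> complex. integrable \<mu> g \<longrightarrow>
        (LINT x|\<mu>. g (\<alpha> h x)) = of_real (\<delta> h) * (LINT x|\<mu>. g x))"

definition D_hat ::
  "('h \<Rightarrow> 'g::topological_ab_group_add \<Rightarrow> 'g) \<Rightarrow> ('h \<Rightarrow> real) \<Rightarrow> 'h \<Rightarrow>
   ('g pontryagin_dual \<Rightarrow> complex) \<Rightarrow> 'g pontryagin_dual \<Rightarrow> complex" where
  "D_hat \<alpha> \<delta> h F \<xi> = of_real (sqrt (\<delta> h)) * F (dual_automorphism (\<alpha> h) \<xi>)"

definition invariant_proper_metric ::
  "('a::{topological_space, ab_group_add} \<Rightarrow> 'a \<Rightarrow> real) \<Rightarrow> bool" where
  "invariant_proper_metric d \<longleftrightarrow>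
     Metric_space UNIV d \<and>
     Metric_space.mtopology UNIV d = euclidean \<and>
     (\<forall>a x y. d (a + x) (a + y) = d x y) \<and>
     (\<forall>x r. compact (Metric_space.mcball UNIV d x r))"

definition weakly_doubling :: "'a::zero measure \<Rightarrow> ('a \<Rightarrow> 'a \<Rightarrow> real) \<Rightarrow> bool" where
  "weakly_doubling \<nu> d \<longleftrightarrow>
     (\<exists>r0 > 0. \<exists>C > 0. \<forall>r. 0 < r \<and> r < r0 \<longrightarrow>
        emeasure \<nu> (Metric_space.mball UNIV d 0 (2 * r))
          \<le> ennreal C * emeasure \<nu> (Metric_space.mball UNIV d 0 r))"

definition measurably_bilipschitz ::
  "'h measure \<Rightarrow> ('a::zero \<Rightarrow> 'a \<Rightarrow> real) \<Rightarrow> ('h \<Rightarrow> 'a \<Rightarrow> 'a) \<Rightarrow>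
   ('h \<Rightarrow> real) \<Rightarrow> ('h \<Rightarrow> real) \<Rightarrow> bool" where
  "measurably_bilipschitz \<sigma> d \<beta> l L \<longleftrightarrow>
     l \<in> borel_measurable \<sigma> \<and> L \<in> borel_measurable \<sigma> \<and>
     (\<forall>h. l h > 0 \<and> L h > 0) \<and>
     (\<forall>h \<xi>. l h * d \<xi> 0 \<le> d (\<beta> h \<xi>) 0 \<and> d (\<beta> h \<xi>) 0 \<le> L h * d \<xi> 0)"

text \<open>A map from the positive reals to themselves is a function on all reals of which only the
  values on \<open>{0<..}\<close> are constrained.\<close>

definition uniformly_expanding ::
  "'h measure \<Rightarrow> ('a::zero \<Rightarrow> 'a \<Rightarrow> real) \<Rightarrow> ('h \<Rightarrow> 'a \<Rightarrow> 'a) \<Rightarrow>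
   ('h \<Rightarrow> real) \<Rightarrow> ('h \<Rightarrow> real) \<Rightarrow> (real \<Rightarrow> real) \<Rightarrow> bool" where
  "uniformly_expanding \<sigma> d \<beta> l L f \<longleftrightarrow>
     measurably_bilipschitz \<sigma> d \<beta> l L \<and>
     (\<forall>t > 0. f t > 0) \<and> mono_on {0<..} f \<and>
     (\<exists>M > 0. \<forall>h. L h > M \<longrightarrow> L h \<le> f (l h))"

text \<open>The library's essential supremum is \<open>\<top>\<close> for non-measurable functions, so
  finiteness includes measurability.\<close>

definition in_Linfty :: "real set \<Rightarrow> (real \<Rightarrow> ennreal) \<Rightarrow> bool" where
  "in_Linfty S u \<longleftrightarrow> esssup (lebesgue_on S) u < \<infinity>"

definition in_L1_loc ::
  "'a measure \<Rightarrow> ('a \<Rightarrow> 'a \<Rightarrow> real) \<Rightarrow> 'a set \<Rightarrow> ('a \<Rightarrow> ennreal) \<Rightarrow> bool" where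
  "in_L1_loc \<nu> d S F \<longleftrightarrow>
     F \<in> borel_measurable \<nu> \<and>
     (\<forall>\<xi>\<^sub>0 \<in> S. \<exists>\<epsilon> > 0. (\<integral>\<^sup>+ \<xi> \<in> Metric_space.mball UNIV d \<xi>\<^sub>0 \<epsilon>. F \<xi> \<partial>\<nu>) < \<infinity>)"

end

theory Submission
  imports Defs
begin

text \<open>The dual automorphism of \<open>\<alpha>\<^sub>h\<close> scales \<open>\<nu>\<close> by \<open>1 / \<delta>(h)\<close>: it maps \<open>\<nu>\<close> to a Haar measure, and by
  Plancherel the constant can be read off from the Fourier transform of the indicator of a compact set.
  Hence, by Tonelli, the integral of \<open>\<Psi>\<close> over a ball \<open>B\<close> is the integral of \<open>|\<psi>_hat(\<eta>)|\<^sup>2\<close> weighted by the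
  measure of the \<open>h\<close> with \<open>L(h) > M'\<close> and \<open>\<eta>\<close> in the image of \<open>B\<close>. For \<open>B\<close> of radius \<open>R / 2\<close> around a
  point at distance \<open>R > 0\<close> from \<open>0\<close>, every such \<open>h\<close> satisfies \<open>t \<le> L(h)\<close> and \<open>l(h) \<le> 3 t\<close> with
  \<open>t = 2 d(\<eta>, 0) / (3 R)\<close>, hence \<open>t \<le> L(h) \<le> f(3 t)\<close>, and the hypothesis bounds this weight
  uniformly in \<open>\<eta>\<close>.\<close>

subsection \<open>Measurability in separable groups with an invariant metric\<close>

text \<open>The metric on the dual group is a function compatible with a given topology, not part of
  its type class. The countable dense set \<open>D\<close> plays the role of second countability in
  all measurability arguments below.\<close>

locale separable_metric_group = Metric_space UNIV d
  for d :: "'a::{topological_space, ab_group_add} \<Rightarrow> 'a \<Rightarrow> real" +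
  fixes D :: "'a set"
  assumes mtopology_eq: "mtopology = euclidean"
    and translation_invariant: "d (a + x) (a + y) = d x y"
    and countable_D: "countable D"
    and dense_D: "e > 0 \<Longrightarrow> \<exists>y\<in>D. d x y < e"
begin

lemma open_iff_mball: "open U \<longleftrightarrow> (\<forall>x\<in>U. \<exists>r>0. mball x r \<subseteq> U)"
  using openin_mtopology[of U] by (auto simp: mtopology_eq)

lemma open_mball [simp]: "open (mball x r)"
  using openin_mball[of x r] by (simp add: mtopology_eq)

lemma mball_borel [measurable]: "mball x r \<in> sets borel"
  by simp

lemma d_diff_left: "d (x - y) z = d x (z + y)"
  using translation_invariant[of y "x - y" z] by (simp add: add.commute)

lemma d_diff_zero: "d (x - y) 0 = d x y"
  by (simp add: d_diff_left)

lemma d_minus_zero: "d (- x) 0 = d x 0"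
  using translation_invariant[of x "-x" 0] by (simp add: commute)

lemma minus_image_mball_zero: "- x \<in> mball 0 r \<longleftrightarrow> x \<in> mball 0 r"
  using d_minus_zero[of x] by (simp add: commute)

lemma translate_mball: "(+) a ` mball x r = mball (a + x) r"
proof -
  have "y \<in> (+) a ` mball x r" if "d (a + x) y < r" for y
    using that translation_invariant[of a x "y - a"] by (intro image_eqI[of _ _ "y - a"]) auto
  then show ?thesis
    by (auto simp: translation_invariant)
qed

text \<open>Balls with centres in \<open>D\<close> and rational radii form a countable base. Centre
  and radius are both within \<open>r / 2\<close>, so the ball around \<open>y\<close> stays within
  distance \<open>r\<close> of \<open>x\<close>.\<close>

lemma exists_rational_mball_subset:
  assumes "open U" "x \<in> U"
  shows "\<exists>y\<in>D. \<exists>q::rat. d x y < of_rat q \<and> mball y (of_rat q) \<subseteq> U"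
proof -
  obtain r where r: "r > 0" "mball x r \<subseteq> U"
    using assms by (auto simp: open_iff_mball)
  obtain y where y: "y \<in> D" "d x y < r / 2"
    using dense_D[of "r / 2" x] r by auto
  obtain q :: rat where q: "d x y < of_rat q" "of_rat q < r / 2"
    using of_rat_dense[OF y(2)] by auto
  have "mball y (of_rat q) \<subseteq> mball x r"
  proof
    fix z assume "z \<in> mball y (of_rat q)"
    then show "z \<in> mball x r"
      using triangle[of x y z] y q by simp
  qed
  then show ?thesis
    using r y q by blast
qed

text \<open>For each basic ball contained in some member of the family, one such member is chosen;
  there are only countably many basic balls. This later tames the arbitrary unions in the
  compact-open topology.\<close>

lemma Lindelof_mball:
  fixes \<U> :: "'a set set"
  assumes "\<And>U. U \<in> \<U> \<Longrightarrow> open U"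
  obtains \<V> where "\<V> \<subseteq> \<U>" "countable \<V>" "\<Union>\<V> = \<Union>\<U>"
proof -
  define P where "P = {(y, q::rat). y \<in> D \<and> (\<exists>U\<in>\<U>. mball y (of_rat q) \<subseteq> U)}"
  have "P \<subseteq> D \<times> UNIV"
    by (auto simp: P_def)
  then have cP: "countable P"
    by (rule countable_subset) (simp add: countable_D)
  have "\<forall>p\<in>P. \<exists>U\<in>\<U>. mball (fst p) (of_rat (snd p)) \<subseteq> U"
    by (auto simp: P_def)
  then obtain F where F: "\<And>p. p \<in> P \<Longrightarrow> F p \<in> \<U> \<and> mball (fst p) (of_rat (snd p)) \<subseteq> F p"
    by metis
  show ?thesis
  proof (rule that)
    show "F ` P \<subseteq> \<U>"
      using F by auto
    show "countable (F ` P)"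
      using cP by simp
    have "x \<in> \<Union>(F ` P)" if U: "U \<in> \<U>" "x \<in> U" for x U
    proof -
      obtain y q where "y \<in> D" "d x y < of_rat q" "mball y (of_rat q) \<subseteq> U"
        using exists_rational_mball_subset[OF assms[OF U(1)] U(2)] by auto
      then have "(y, q) \<in> P" "x \<in> mball y (of_rat q)"
        using U by (auto simp: P_def commute)
      then show ?thesis
        using F[of "(y, q)"] by auto
    qed
    then show "\<Union>(F ` P) = \<Union>\<U>"
      using \<open>F ` P \<subseteq> \<U>\<close> by auto
  qed
qed

lemma measurable_d_const [measurable]: "d a \<in> borel_measurable borel"
  unfolding borel_measurable_iff_less
proof (intro allI)
  fix r
  have "{w \<in> space borel. d a w < r} = mball a r"
    by auto
  then show "{w \<in> space borel. d a w < r} \<in> sets borel"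
    by simp
qed

text \<open>Every open set is a countable union of balls centred in \<open>D\<close>, so it is
  enough to test preimages of these.\<close>

lemma measurable_if_vimage_mball:
  fixes \<phi> :: "'b \<Rightarrow> 'a"
  assumes "\<And>y q. y \<in> D \<Longrightarrow> {z \<in> space M. d (\<phi> z) y < q} \<in> sets M"
  shows "\<phi> \<in> borel_measurable M"
proof (rule borel_measurableI)
  fix U :: "'a set" assume U: "open U"
  define P where "P = {(y, q::rat). y \<in> D \<and> mball y (of_rat q) \<subseteq> U}"
  have "P \<subseteq> D \<times> UNIV"
    by (auto simp: P_def)
  then have cP: "countable P"
    by (rule countable_subset) (simp add: countable_D)
  have "\<phi> -` U \<inter> space M = (\<Union>p\<in>P. {z \<in> space M. d (\<phi> z) (fst p) < of_rat (snd p)})"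
    using exists_rational_mball_subset[OF U] by (fastforce simp: P_def commute)
  also have "\<dots> \<in> sets M"
    using cP by (intro sets.countable_UN'') (auto simp: P_def intro!: assms)
  finally show "\<phi> -` U \<inter> space M \<in> sets M" .
qed

text \<open>The triangle inequality through points of \<open>D\<close> is sharp up to arbitrarily
  small errors. This turns a condition on two varying points into countably many conditions on
  distances to fixed points.\<close>

lemma measurable_d [measurable (raw)]:
  assumes [measurable]: "\<phi> \<in> borel_measurable M" "\<psi> \<in> borel_measurable M"
  shows "(\<lambda>z. d (\<phi> z) (\<psi> z)) \<in> borel_measurable M"
  unfolding borel_measurable_iff_less
proof (intro allI)
  fix r :: real
  have "{z \<in> space M. d (\<phi> z) (\<psi> z) < r} =
    (\<Union>y\<in>D. {z \<in> space M. d y (\<phi> z) + d y (\<psi> z) < r})"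
  proof safe
    fix z assume z: "z \<in> space M" "d (\<phi> z) (\<psi> z) < r"
    \<comment> \<open>Half of the gap suffices: the sum of the two distances to \<open>y\<close>
      exceeds \<open>d (\<phi> z) (\<psi> z)\<close> by at most twice the distance from
      \<open>y\<close> to \<open>\<phi> z\<close>.\<close>
    obtain y where y: "y \<in> D" "d (\<phi> z) y < (r - d (\<phi> z) (\<psi> z)) / 2"
      using dense_D[of "(r - d (\<phi> z) (\<psi> z)) / 2"] z by auto
    have "d y (\<phi> z) + d y (\<psi> z) < r"
      using y(2) triangle[of y "\<phi> z" "\<psi> z"] commute[of y "\<phi> z"] by simp
    then show "z \<in> (\<Union>y\<in>D. {z \<in> space M. d y (\<phi> z) + d y (\<psi> z) < r})"
      using y z by auto
  next
    fix z y assume "d y (\<phi> z) + d y (\<psi> z) < r"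
    then show "d (\<phi> z) (\<psi> z) < r"
      using triangle[of "\<phi> z" y "\<psi> z"] commute[of y "\<phi> z"] by simp
  qed
  also have "\<dots> \<in> sets M"
    by (intro sets.countable_UN'' countable_D) measurable
  finally show "{z \<in> space M. d (\<phi> z) (\<psi> z) < r} \<in> sets M" .
qed

text \<open>By invariance, the distance of a sum to \<open>y\<close> is the distance of
  \<open>\<phi> z\<close> to \<open>y - \<psi> z\<close>, which reduces addition to joint
  measurability of \<open>d\<close>. The same shift handles \<open>y - \<psi> z\<close>
  itself.\<close>

lemma measurable_add:
  fixes \<phi> \<psi> :: "'b \<Rightarrow> 'a"
  assumes [measurable]: "\<phi> \<in> borel_measurable M" "\<psi> \<in> borel_measurable M"
  shows "(\<lambda>z. \<phi> z + \<psi> z) \<in> borel_measurable M"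
proof (rule measurable_if_vimage_mball)
  fix y q assume "y \<in> D"
  have neg: "(\<lambda>z. y - \<psi> z) \<in> borel_measurable M"
  proof (rule measurable_if_vimage_mball)
    fix x q assume "x \<in> D"
    have "d (y - \<psi> z) x = d (\<psi> z) (y - x)" for z
      using d_diff_left[of y "\<psi> z" x] d_diff_left[of y x "\<psi> z"] by (simp add: add.commute commute)
    then show "{z \<in> space M. d (y - \<psi> z) x < q} \<in> sets M"
      by simp
  qed
  have "d (\<phi> z + \<psi> z) y = d (\<phi> z) (y - \<psi> z)" for z
    using d_diff_left[of y "\<psi> z" "\<phi> z"] by (simp add: commute)
  then show "{z \<in> space M. d (\<phi> z + \<psi> z) y < q} \<in> sets M"
    using neg by simp
qed

lemma measurable_uminus:
  "(uminus :: 'a \<Rightarrow> 'a) \<in> borel_measurable borel"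
proof (rule measurable_if_vimage_mball)
  fix y q
  have "d (- z) y = d z (- y)" for z
    using d_diff_left[of 0 z y] translation_invariant[of "- y" 0 "y + z"]
    by (simp add: commute)
  then show "{z \<in> space borel. d (- z) y < q} \<in> sets borel"
    by simp
qed

end

section \<open>Separability from compactness of closed balls\<close>

lemma separable_metric_group_if_proper:
  fixes d :: "'a::{topological_space, ab_group_add} \<Rightarrow> 'a \<Rightarrow> real"
  assumes "invariant_proper_metric d"
  shows "\<exists>D. separable_metric_group d D"
proof -
  interpret Metric_space UNIV d
    using assms by (simp add: invariant_proper_metric_def)
  have top: "mtopology = euclidean"
    and inv: "\<And>a x y. d (a + x) (a + y) = d x y"
    and cpt: "\<And>x r. compact (mcball x r)"
    using assms by (auto simp: invariant_proper_metric_def)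
  \<comment> \<open>The dense set consists of the centres of finite nets of mesh
    \<open>1 / Suc k\<close> in the balls of radius \<open>n\<close>, which exhaust the
    group.\<close>
  have "mtotally_bounded (mcball 0 (real n))" for n
    using cpt[of 0 "real n"] by (intro compactin_imp_mtotally_bounded) (simp add: top)
  then have "\<forall>n k. \<exists>K. finite K \<and> mcball 0 (real n) \<subseteq> (\<Union>x\<in>K. mball x (1 / real (Suc k)))"
    unfolding mtotally_bounded_def by (metis of_nat_0_less_iff zero_less_Suc zero_less_divide_1_iff)
  then obtain K where K: "\<And>n k. finite (K n k)"
      "\<And>n k. mcball 0 (real n) \<subseteq> (\<Union>x\<in>K n k. mball x (1 / real (Suc k)))"
    by metis
  have "separable_metric_group d (\<Union>n k. K n k)"
  proof unfold_locales
    show "countable (\<Union>n k. K n k)"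
      by (intro countable_UN) (auto simp: K(1) countable_finite)
    fix x and e :: real assume "e > 0"
    then obtain k where k: "1 / real (Suc k) < e"
      using nat_approx_posE by blast
    obtain n where "d 0 x \<le> real n"
      using real_arch_simple by blast
    then have "x \<in> mcball 0 (real n)"
      by simp
    then obtain y where "y \<in> K n k" "d y x < 1 / real (Suc k)"
      using K(2)[of n k] by auto
    then show "\<exists>y\<in>\<Union>n k. K n k. d x y < e"
      using k by (force simp: commute)
  qed (auto simp: top inv)
  then show ?thesis
    by blast
qed

subsection \<open>Uniqueness of Haar measure\<close>

lemma haar_measure_finite_ball:
  assumes "haar_measure M" "invariant_proper_metric d"
  shows "emeasure M (Metric_space.mball UNIV d x r) < \<infinity>"
proof -
  interpret Metric_space UNIV d
    using assms by (simp add: invariant_proper_metric_def)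
  have "compact (mcball x r)" "sets M = sets borel"
    using assms by (auto simp: haar_measure_def invariant_proper_metric_def)
  moreover have "closed (mcball x r)"
    using closedin_mcball[of x r] assms by (metis closed_closedin invariant_proper_metric_def)
  ultimately have "emeasure M (mball x r) \<le> emeasure M (mcball x r)" "emeasure M (mcball x r) < \<infinity>"
    using assms by (auto simp: haar_measure_def intro!: emeasure_mono mball_subset_mcball)
  then show ?thesis
    by (rule order.strict_trans1)
qed

context separable_metric_group
begin

text \<open>If the ball were null, so would be its translates by the points of \<open>D\<close>;
  these are countably many and cover the group.\<close>

lemma haar_measure_mball_pos:
  assumes "haar_measure M" "r > 0"
  shows "emeasure M (mball 0 r) > 0"
proof (rule ccontr)
  have sets: "sets M = sets borel"
    using assms by (simp add: haar_measure_def)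
  assume "\<not> ?thesis"
  then have "emeasure M (mball y r) = 0" for y
    using assms translate_mball[of y 0 r] by (simp add: haar_measure_def) (metis borel_open open_mball)
  then have "emeasure M (\<Union>y\<in>D. mball y r) = 0"
    by (intro null_setsD1 null_sets_UN' countable_D) (simp add: null_sets_def sets)
  moreover have "(\<Union>y\<in>D. mball y r) = UNIV"
    using dense_D[OF \<open>r > 0\<close>] by (fastforce simp: commute)
  ultimately show False
    using assms by (simp add: haar_measure_def)
qed

lemma sigma_finite_if_finite_mball:
  assumes "sets M = sets borel" "\<And>r. emeasure M (mball 0 r) < \<infinity>"
  shows "sigma_finite_measure M"
proof
  have "x \<in> (\<Union>n. mball 0 (real n))" for x
    using reals_Archimedean2[of "d 0 x"] by auto
  then show "\<exists>A. countable A \<and> A \<subseteq> sets M \<and> \<Union> A = space M \<and> (\<forall>a\<in>A. emeasure M a \<noteq> \<infinity>)"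
    using assms sets_eq_imp_space_eq[OF assms(1)]
    by (intro exI[of _ "range (\<lambda>n. mball 0 (real n))"]) (auto simp: less_top)
qed

lemma nn_integral_translate:
  fixes M :: "'a measure"
  assumes M: "haar_measure M" and g: "g \<in> borel_measurable borel"
  shows "(\<integral>\<^sup>+ x. g (a + x) \<partial>M) = (\<integral>\<^sup>+ x. g x \<partial>M)"
proof -
  have sets: "sets M = sets borel"
    using M by (simp add: haar_measure_def)
  have add: "(+) a \<in> borel_measurable M"
    by (intro measurable_add) (simp_all add: sets cong: measurable_cong_sets)
  have "distr M borel ((+) a) = M"
  proof (rule measure_eqI)
    fix A assume "A \<in> sets (distr M borel ((+) a))"
    then have A: "A \<in> sets borel"
      by simp
    have "(+) a -` A = (+) (- a) ` A"
      by (force simp: image_iff)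
    moreover have "emeasure M ((+) (- a) ` A) = emeasure M A"
      using M A unfolding haar_measure_def by blast
    ultimately show "emeasure (distr M borel ((+) a)) A = emeasure M A"
      using A add sets_eq_imp_space_eq[OF sets] by (simp add: emeasure_distr)
  qed (simp add: sets)
  then have "(\<integral>\<^sup>+ x. g x \<partial>M) = (\<integral>\<^sup>+ x. g x \<partial>distr M borel ((+) a))"
    by simp
  also have "\<dots> = (\<integral>\<^sup>+ x. g (a + x) \<partial>M)"
    using add g by (intro nn_integral_distr) simp_all
  finally show ?thesis ..
qed

text \<open>Double integration of \<open>f x * g (x + y)\<close> with \<open>f\<close> the indicator of a ball around \<open>0\<close>:
  the symmetry of such balls replaces the general inversion invariance of Haar measure.\<close>

lemma haar_measure_unique:
  fixes M N :: "'a measure"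
  assumes M: "haar_measure M" "\<And>r. emeasure M (mball 0 r) < \<infinity>"
    and N: "haar_measure N" "\<And>r. emeasure N (mball 0 r) < \<infinity>"
    and g: "g \<in> borel_measurable borel"
  shows "emeasure M (mball 0 r) * (\<integral>\<^sup>+ x. g x \<partial>N) = emeasure N (mball 0 r) * (\<integral>\<^sup>+ x. g x \<partial>M)"
proof -
  have sM [measurable_cong]: "sets M = sets borel" and sN [measurable_cong]: "sets N = sets borel"
    using M N by (auto simp: haar_measure_def)
  note g [measurable]
  interpret sM: sigma_finite_measure M
    by (rule sigma_finite_if_finite_mball) (use sM M in auto)
  interpret sN: sigma_finite_measure N
    by (rule sigma_finite_if_finite_mball) (use sN N in auto)
  interpret MN: pair_sigma_finite M N ..
  define f :: "'a \<Rightarrow> ennreal" where "f = indicator (mball 0 r)"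
  have f [measurable]: "f \<in> borel_measurable borel"
    by (simp add: f_def)
  have f_minus: "f (- x) = f x" for x
    by (simp add: f_def indicator_def minus_image_mball_zero del: in_mball)
  have add_meas [measurable]: "(\<lambda>p. fst p + snd p) \<in> M \<Otimes>\<^sub>M N \<rightarrow>\<^sub>M borel"
    by (rule measurable_add) measurable
  have neg_meas [measurable]: "(\<lambda>p. - snd p + fst p) \<in> M \<Otimes>\<^sub>M N \<rightarrow>\<^sub>M borel"
    by (intro measurable_add measurable_compose[OF _ measurable_uminus]) measurable
  have m1: "(\<lambda>(x, y). f x * g (x + y)) \<in> borel_measurable (M \<Otimes>\<^sub>M N)"
    using measurable_compose[OF add_meas g] by (simp add: case_prod_beta)
  have m2: "(\<lambda>(x, y). f (- y + x) * g x) \<in> borel_measurable (M \<Otimes>\<^sub>M N)"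
    using measurable_compose[OF neg_meas f] by (simp add: case_prod_beta)
  have tr: "(\<lambda>x. h (a + x)) \<in> borel_measurable borel" if "h \<in> borel_measurable borel"
    for h :: "'a \<Rightarrow> ennreal" and a
    by (rule measurable_compose[OF _ that]) (intro measurable_add, simp_all)
  have "emeasure M (mball 0 r) * (\<integral>\<^sup>+ x. g x \<partial>N) = (\<integral>\<^sup>+ x. f x * (\<integral>\<^sup>+ y. g y \<partial>N) \<partial>M)"
    by (subst nn_integral_multc) (auto simp: f_def sM)
  \<comment> \<open>Invariance of \<open>N\<close> replaces the integral of \<open>g\<close> by that
    of its translate by \<open>x\<close>, for each \<open>x\<close>.\<close>
  also have "\<dots> = (\<integral>\<^sup>+ x. (\<integral>\<^sup>+ y. f x * g (x + y) \<partial>N) \<partial>M)"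
    using tr[OF g] by (simp add: nn_integral_cmult nn_integral_translate[OF N(1) g] cong: measurable_cong_sets)
  also have "\<dots> = (\<integral>\<^sup>+ y. (\<integral>\<^sup>+ x. f x * g (x + y) \<partial>M) \<partial>N)"
    using MN.Fubini'[OF m1] ..
  \<comment> \<open>For fixed \<open>y\<close>, invariance of \<open>M\<close> under translation by
    \<open>- y\<close> moves the shift from \<open>g\<close> to \<open>f\<close>.\<close>
  also have "\<dots> = (\<integral>\<^sup>+ y. (\<integral>\<^sup>+ x. f (- y + x) * g x \<partial>M) \<partial>N)"
  proof (rule nn_integral_cong)
    fix y
    have "(\<lambda>x. f x * g (x + y)) \<in> borel_measurable borel"
      using tr[OF g, of y] by (simp add: add.commute)
    from nn_integral_translate[OF M(1) this, of "- y"]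
    show "(\<integral>\<^sup>+ x. f x * g (x + y) \<partial>M) = (\<integral>\<^sup>+ x. f (- y + x) * g x \<partial>M)"
      by simp
  qed
  also have "\<dots> = (\<integral>\<^sup>+ x. (\<integral>\<^sup>+ y. f (- y + x) * g x \<partial>N) \<partial>M)"
    using MN.Fubini'[OF m2] .
  \<comment> \<open>Since \<open>f\<close> is even, the argument of \<open>f\<close> may change
    sign; now \<open>y\<close> occurs as a translated variable and invariance of \<open>N\<close>
    applies again.\<close>
  also have "\<dots> = (\<integral>\<^sup>+ x. (\<integral>\<^sup>+ y. g x * f (- x + y) \<partial>N) \<partial>M)"
  proof (intro nn_integral_cong)
    fix x y
    show "f (- y + x) * g x = g x * f (- x + y)"
      using f_minus[of "- y + x"] by (simp add: mult.commute)
  qed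
  also have "\<dots> = (\<integral>\<^sup>+ x. g x * (\<integral>\<^sup>+ y. f y \<partial>N) \<partial>M)"
    using tr[OF f] by (simp add: nn_integral_cmult nn_integral_translate[OF N(1) f] del: add_uminus_conv_diff uminus_add_conv_diff cong: measurable_cong_sets)
  also have "\<dots> = emeasure N (mball 0 r) * (\<integral>\<^sup>+ x. g x \<partial>M)"
    by (subst nn_integral_multc) (auto simp: f_def sN mult.commute)
  finally show ?thesis .
qed

end

subsection \<open>Characters and dual automorphisms\<close>

text \<open>One point of \<open>K\<close> is picked from every basic open set that meets
  \<open>K\<close>. Conditions on all of a compact set can then be tested at countably many
  points.\<close>

lemma countable_dense_subset:
  fixes K :: "'a::second_countable_topology set"
  obtains C where "countable C" "C \<subseteq> K" "K \<subseteq> closure C"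
proof -
  obtain B :: "'a set set" where B: "countable B" "topological_basis B"
    using ex_countable_basis by blast
  define C where "C = (\<lambda>b. SOME x. x \<in> b \<inter> K) ` {b \<in> B. b \<inter> K \<noteq> {}}"
  have some: "(SOME x. x \<in> b \<inter> K) \<in> b \<inter> K" if "b \<inter> K \<noteq> {}" for b
    using that by (metis ex_in_conv someI_ex)
  show ?thesis
  proof (rule that)
    show "countable C"
      using B by (simp add: C_def)
    show "C \<subseteq> K"
      using some by (auto simp: C_def)
    show "K \<subseteq> closure C"
    proof
      fix x assume x: "x \<in> K"
      show "x \<in> closure C"
        unfolding closure_iff_nhds_not_empty
      proof safe
        fix A U assume "U \<subseteq> A" "open U" "x \<in> U" "C \<inter> A = {}"
        then obtain b where "b \<in> B" "x \<in> b" "b \<subseteq> U"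
          using B topological_basisE by blast
        then show False
          using some[of b] x \<open>U \<subseteq> A\<close> \<open>C \<inter> A = {}\<close> by (fastforce simp: C_def)
      qed
    qed
  qed
qed

lemma sets_Collect_ball_countable:
  assumes "countable C" "\<And>x. x \<in> C \<Longrightarrow> {h \<in> space M. P h x} \<in> sets M"
  shows "{h \<in> space M. \<forall>x\<in>C. P h x} \<in> sets M"
proof -
  have "{h \<in> space M. \<forall>x\<in>C. P h x} = space M - (\<Union>x\<in>C. space M - {h \<in> space M. P h x})"
    by auto
  also have "\<dots> \<in> sets M"
    using assms by (intro sets.Diff sets.top sets.countable_UN'')
  finally show ?thesis .
qed

lemma continuous_on_pairing: "continuous_on UNIV (pairing \<xi>)"
  using pairing[of \<xi>] by simp

lemma measurable_pairing [measurable]: "pairing \<xi> \<in> borel_measurable borel"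
  by (intro borel_measurable_continuous_onI continuous_on_pairing)

lemma norm_pairing [simp]: "norm (pairing \<xi> x) = 1"
  using pairing[of \<xi>] by simp

text \<open>The compact image of \<open>K\<close> has positive distance from the closed complement
  of \<open>V\<close>; conversely, by continuity, a lower bound on this distance passes from
  \<open>C\<close> to its closure. Subbasic sets of the compact-open topology thus become countable
  conditions on values of characters.\<close>

lemma pairing_image_subset_iff:
  assumes "compact K" "open V" "C \<subseteq> K" "K \<subseteq> closure C"
  shows "pairing \<xi> ` K \<subseteq> V \<longleftrightarrow> (\<exists>n. \<forall>x\<in>C. \<forall>y\<in>-V. 1 / real (Suc n) \<le> dist (pairing \<xi> x) y)"
proof
  assume V: "pairing \<xi> ` K \<subseteq> V"
  have "compact (pairing \<xi> ` K)"
    using assms(1) continuous_on_subset[OF continuous_on_pairing] by (intro compact_continuous_image) auto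
  then obtain e where e: "e > 0" "\<forall>x\<in>pairing \<xi> ` K. \<forall>y\<in>-V. e \<le> dist x y"
    using separate_compact_closed[of "pairing \<xi> ` K" "- V"] V assms(2)
    by (metis Int_commute closed_Compl disjoint_eq_subset_Compl double_complement)
  then obtain n where "1 / real (Suc n) < e"
    using nat_approx_posE by blast
  then show "\<exists>n. \<forall>x\<in>C. \<forall>y\<in>-V. 1 / real (Suc n) \<le> dist (pairing \<xi> x) y"
    using e assms(3) by (metis image_eqI less_imp_le order.trans subsetD)
next
  assume "\<exists>n. \<forall>x\<in>C. \<forall>y\<in>-V. 1 / real (Suc n) \<le> dist (pairing \<xi> x) y"
  then obtain n where n: "\<forall>x\<in>C. \<forall>y\<in>-V. 1 / real (Suc n) \<le> dist (pairing \<xi> x) y"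
    by blast
  have "closed {x. \<forall>y\<in>-V. 1 / real (Suc n) \<le> dist (pairing \<xi> x) y}"
    unfolding Ball_def
    by (intro closed_Collect_all closed_Collect_imp closed_Collect_le continuous_intros continuous_on_pairing) auto
  then have "closure C \<subseteq> {x. \<forall>y\<in>-V. 1 / real (Suc n) \<le> dist (pairing \<xi> x) y}"
    using n by (intro closure_minimal) auto
  then have "\<forall>x\<in>K. \<forall>y\<in>-V. 1 / real (Suc n) \<le> dist (pairing \<xi> x) y"
    using assms(4) by blast
  moreover have "\<not> 1 / real (Suc n) \<le> dist z z" for z :: complex
    by simp
  ultimately show "pairing \<xi> ` K \<subseteq> V"
    by blast
qed

text \<open>Induction over the generation of open sets: subbasic sets are countable combinations of
  conditions on single values, and unions of any size reduce to countable ones because each member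
  is open.\<close>

lemma measurable_into_dual:
  fixes \<gamma> :: "'h \<Rightarrow> 'g::{topological_ab_group_add, second_countable_topology} pontryagin_dual"
  assumes "separable_metric_group d (D :: 'g pontryagin_dual set)"
    and \<gamma>: "\<And>x. (\<lambda>h. pairing (\<gamma> h) x) \<in> borel_measurable M"
  shows "\<gamma> \<in> borel_measurable M"
proof (rule borel_measurableI)
  interpret separable_metric_group d D
    by fact
  fix U :: "'g pontryagin_dual set" assume "open U"
  then have "generate_topology {{\<xi>. pairing \<xi> ` K \<subseteq> V} | K V. compact K \<and> open V} U"
    by (simp add: open_pontryagin_dual_def)
  then have "{h \<in> space M. \<gamma> h \<in> U} \<in> sets M"
  proof induction
    case (Int a b)
    then show ?case
      using sets.sets_Collect_conj by auto
  next
    case (UN \<U>)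
    have "open U" if "U \<in> \<U>" for U
      using UN.hyps[OF that] by (simp add: open_pontryagin_dual_def)
    then obtain \<V> where V: "\<V> \<subseteq> \<U>" "countable \<V>" "\<Union>\<V> = \<Union>\<U>"
      using Lindelof_mball by metis
    have "{h \<in> space M. \<gamma> h \<in> \<Union>\<U>} = (\<Union>U\<in>\<V>. {h \<in> space M. \<gamma> h \<in> U})"
      unfolding V(3)[symmetric] by auto
    also have "\<dots> \<in> sets M"
      using V UN.IH by (intro sets.countable_UN'') auto
    finally show ?case .
  next
    case (Basis s)
    then obtain K V where KV: "compact K" "open V" "s = {\<xi>. pairing \<xi> ` K \<subseteq> V}"
      by blast
    obtain C where C: "countable C" "C \<subseteq> K" "K \<subseteq> closure C"
      using countable_dense_subset by blast
    have "closed {z. \<forall>y\<in>-V. 1 / real (Suc n) \<le> dist z y}" for n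
      unfolding Ball_def
      by (intro closed_Collect_all closed_Collect_imp closed_Collect_le continuous_intros) auto
    then have "{h \<in> space M. pairing (\<gamma> h) x \<in> {z. \<forall>y\<in>-V. 1 / real (Suc n) \<le> dist z y}} \<in> sets M" for n x
      by (intro measurable_sets_Collect[OF \<gamma>]) auto
    then have "{h \<in> space M. \<forall>y\<in>-V. 1 / real (Suc n) \<le> dist (pairing (\<gamma> h) x) y} \<in> sets M" for n x
      by simp
    then have "{h \<in> space M. \<exists>n. \<forall>x\<in>C. \<forall>y\<in>-V. 1 / real (Suc n) \<le> dist (pairing (\<gamma> h) x) y} \<in> sets M"
      by (rule sets.sets_Collect_countable_Ex[OF sets_Collect_ball_countable[OF C(1)]])
    then show ?case
      unfolding KV(3) mem_Collect_eq pairing_image_subset_iff[OF KV(1,2) C(2,3)] .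
  qed simp
  then show "\<gamma> -` U \<inter> space M \<in> sets M"
    by (simp add: vimage_def Int_def conj_commute)
qed

lemma pairing_add: "pairing (\<xi> + \<eta>) x = pairing \<xi> x * pairing \<eta> x"
  by (simp add: plus_pontryagin_dual.rep_eq)

section \<open>Algebra of dual automorphisms\<close>

lemma is_automorphism_inv:
  assumes "is_automorphism \<phi>"
  shows "is_automorphism (inv \<phi>)"
proof -
  have \<phi>: "\<And>x y. \<phi> (x + y) = \<phi> x + \<phi> y" "bij \<phi>" "continuous_on UNIV \<phi>" "continuous_on UNIV (inv \<phi>)"
    using assms by (auto simp: is_automorphism_def)
  have "inv \<phi> (x + y) = inv \<phi> x + inv \<phi> y" for x y
    by (rule inv_f_eq) (simp_all add: \<phi>(1) bij_is_inj[OF \<phi>(2)] surj_f_inv_f[OF bij_is_surj[OF \<phi>(2)]])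
  then show ?thesis
    using \<phi> by (simp add: is_automorphism_def bij_imp_bij_inv inv_inv_eq)
qed

lemma pairing_dual_automorphism_inv:
  assumes "is_automorphism \<phi>"
  shows "pairing (dual_automorphism (inv \<phi>) \<xi>) x = pairing \<xi> (\<phi> x)"
  using pairing_dual_automorphism[OF is_automorphism_inv[OF assms]] assms
  by (simp add: is_automorphism_def inv_inv_eq)

lemma dual_automorphism_add:
  assumes "is_automorphism \<phi>"
  shows "dual_automorphism \<phi> (\<xi> + \<eta>) = dual_automorphism \<phi> \<xi> + dual_automorphism \<phi> \<eta>"
  by (simp add: pairing_inject[symmetric] fun_eq_iff pairing_dual_automorphism[OF assms] pairing_add)

lemma dual_automorphism_diff:
  assumes "is_automorphism \<phi>"
  shows "dual_automorphism \<phi> (\<xi> - \<eta>) = dual_automorphism \<phi> \<xi> - dual_automorphism \<phi> \<eta>"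
  using dual_automorphism_add[OF assms, of "\<xi> - \<eta>" \<eta>] by (simp add: algebra_simps)

lemma dual_automorphism_inverse:
  assumes "is_automorphism \<phi>"
  shows "dual_automorphism \<phi> (dual_automorphism (inv \<phi>) \<xi>) = \<xi>"
    and "dual_automorphism (inv \<phi>) (dual_automorphism \<phi> \<xi>) = \<xi>"
  using assms unfolding is_automorphism_def
  by (simp_all add: pairing_inject[symmetric] fun_eq_iff pairing_dual_automorphism[OF assms]
      pairing_dual_automorphism_inv[OF assms] bij_is_inj bij_is_surj surj_f_inv_f)

text \<open>Otherwise every open set inside a compact set is null, and by Lindelof countably many of
  these cover the group. The set \<open>K\<close> supplies the test function for Plancherel in
  \<open>nn_integral_T\<close>.\<close>

lemma haar_measure_compact_pos:
  fixes \<mu> :: "'g::{second_countable_topology, t2_space, ab_group_add} measure"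
  assumes "locally_compact_space (euclidean :: 'g topology)" "haar_measure \<mu>"
  shows "\<exists>K. compact K \<and> 0 < emeasure \<mu> K \<and> emeasure \<mu> K < \<infinity>"
proof (rule ccontr)
  have sets: "sets \<mu> = sets borel"
    using assms by (simp add: haar_measure_def)
  assume no_K: "\<not> ?thesis"
  have zero: "emeasure \<mu> K = 0" if "compact K" for K
    using that no_K assms(2) unfolding haar_measure_def by (metis gr_zeroI)
  define \<U> where "\<U> = {U::'g set. open U \<and> (\<exists>K. compact K \<and> U \<subseteq> K)}"
  obtain \<V> where V: "\<V> \<subseteq> \<U>" "countable \<V>" "\<Union>\<V> = \<Union>\<U>"
    using Lindelof[of \<U>] by (auto simp: \<U>_def)
  have "\<Union>\<U> = UNIV"
    using assms(1) by (fastforce simp: locally_compact_space_def \<U>_def)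
  moreover have "U \<in> null_sets \<mu>" if U: "U \<in> \<V>" for U
  proof -
    obtain K where "compact K" "U \<subseteq> K" "open U"
      using U V by (auto simp: \<U>_def)
    then show ?thesis
      using zero[of K] sets emeasure_mono[of U K \<mu>] by (auto simp: null_sets_def compact_imp_closed)
  qed
  ultimately have "UNIV \<in> null_sets \<mu>"
    using null_sets_UN'[OF V(2), of "\<lambda>U. U"] V(3) by simp
  then show False
    using assms by (simp add: haar_measure_def null_sets_def)
qed

subsection \<open>The action on the dual group\<close>

locale bilipschitz_dual_action =
  separable_metric_group d D + sH: sigma_finite_measure \<sigma>
  for d :: "'g::{topological_ab_group_add, second_countable_topology, t2_space} pontryagin_dual \<Rightarrow> 'g pontryagin_dual \<Rightarrow> real"
    and D :: "'g pontryagin_dual set" and \<sigma> :: "'h measure" +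
  fixes \<mu> :: "'g measure"
    and \<nu> :: "'g pontryagin_dual measure"
    and \<alpha> :: "'h \<Rightarrow> 'g \<Rightarrow> 'g"
    and \<delta> l L :: "'h \<Rightarrow> real"
  assumes locally_compact: "locally_compact_space (euclidean :: 'g topology)"
    and haar: "haar_measure \<mu>"
    and plancherel: "plancherel_measure \<mu> \<nu>"
    and proper: "invariant_proper_metric d"
    and space_\<sigma>: "space \<sigma> = UNIV"
    and automorphism: "\<And>h. is_automorphism (\<alpha> h)"
    and \<alpha>_measurable: "(\<lambda>(x, h). \<alpha> h x) \<in> \<mu> \<Otimes>\<^sub>M \<sigma> \<rightarrow>\<^sub>M borel"
    and modulus: "modulus \<mu> \<sigma> \<alpha> \<delta>"
    and bilipschitz: "measurably_bilipschitz \<sigma> d (\<lambda>h. dual_automorphism (\<alpha> h)) l L"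
begin

abbreviation T where "T h \<equiv> dual_automorphism (\<alpha> h)"
abbreviation T' where "T' h \<equiv> dual_automorphism (inv (\<alpha> h))"

lemma T_inverse: "T h (T' h \<xi>) = \<xi>" "T' h (T h \<xi>) = \<xi>"
  by (simp_all add: dual_automorphism_inverse automorphism)

lemma haar_\<nu>: "haar_measure \<nu>"
  using plancherel by (simp add: plancherel_measure_def)

lemma sets_\<nu> [measurable_cong]: "sets \<nu> = sets borel"
  using haar_\<nu> by (simp add: haar_measure_def)

lemma space_\<nu>: "space \<nu> = UNIV"
  using sets_eq_imp_space_eq[OF sets_\<nu>] by simp

lemma sets_\<mu>: "sets \<mu> = sets borel"
  using haar by (simp add: haar_measure_def)

lemma finite_mball: "emeasure \<nu> (mball x r) < \<infinity>"
  by (rule haar_measure_finite_ball[OF haar_\<nu> proper])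

sublocale sN: sigma_finite_measure \<nu>
  by (intro sigma_finite_if_finite_mball sets_\<nu> finite_mball)

sublocale NH: pair_sigma_finite \<nu> \<sigma> ..

lemma l_pos: "l h > 0" and L_pos: "L h > 0"
  and l_meas [measurable]: "l \<in> borel_measurable \<sigma>"
  and L_meas [measurable]: "L \<in> borel_measurable \<sigma>"
  using bilipschitz by (auto simp: measurably_bilipschitz_def)

lemma \<delta>_pos: "\<delta> h > 0" and \<delta>_meas [measurable]: "\<delta> \<in> borel_measurable \<sigma>"
  using modulus by (auto simp: modulus_def)

text \<open>Additivity of \<open>T h\<close> and invariance of \<open>d\<close> carry the bounds on
  the distance to 0 over to arbitrary pairs.\<close>

lemma T_upper: "d (T h \<xi>) (T h \<eta>) \<le> L h * d \<xi> \<eta>"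
  and T_lower: "l h * d \<xi> \<eta> \<le> d (T h \<xi>) (T h \<eta>)"
proof -
  have "d (T h (\<xi> - \<eta>)) 0 = d (T h \<xi>) (T h \<eta>)"
    by (simp add: dual_automorphism_diff automorphism d_diff_zero)
  then show "d (T h \<xi>) (T h \<eta>) \<le> L h * d \<xi> \<eta>" "l h * d \<xi> \<eta> \<le> d (T h \<xi>) (T h \<eta>)"
    using bilipschitz by (metis d_diff_zero measurably_bilipschitz_def)+
qed

text \<open>Measurability is assumed for \<open>\<alpha> h x\<close>, not for its inverse. The
  inverse \<open>T' h\<close> pairs through \<open>\<alpha> h\<close> itself, hence it is treated
  before \<open>T h\<close>.\<close>

lemma T'_measurable [measurable]: "(\<lambda>h. T' h \<eta>) \<in> borel_measurable \<sigma>"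
proof (rule measurable_into_dual)
  show "separable_metric_group d D" ..
  fix x
  have "(\<lambda>h. \<alpha> h x) \<in> borel_measurable \<sigma>"
    using measurable_compose[OF measurable_Pair1' \<alpha>_measurable, of x] sets_eq_imp_space_eq[OF sets_\<mu>]
    by simp
  then show "(\<lambda>h. pairing (T' h \<eta>) x) \<in> borel_measurable \<sigma>"
    by (simp add: pairing_dual_automorphism_inv automorphism measurable_compose[OF _ measurable_pairing])
qed

text \<open>A point \<open>T h \<xi>\<close> lies in an open set iff it is close to some \<open>\<eta> \<in> D\<close> in that set, and by the
  Lipschitz bounds this closeness can be tested by \<open>L h * d \<xi> (T' h \<eta>)\<close>, which is jointly measurable.\<close>

lemma T_measurable: "(\<lambda>p. T (snd p) (fst p)) \<in> borel_measurable (\<nu> \<Otimes>\<^sub>M \<sigma>)"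
proof (rule borel_measurableI)
  fix U :: "'g pontryagin_dual set" assume U: "open U"
  define P where "P = {(y, q::rat). y \<in> D \<and> mball y (of_rat q) \<subseteq> U}"
  have "P \<subseteq> D \<times> UNIV"
    by (auto simp: P_def)
  then have cP: "countable P"
    by (rule countable_subset) (simp add: countable_D)
  have test: "(\<exists>p\<in>P. L h * d \<xi> (T' h (fst p)) < of_rat (snd p)) \<longleftrightarrow> T h \<xi> \<in> U" for \<xi> h
  proof
    assume "\<exists>p\<in>P. L h * d \<xi> (T' h (fst p)) < of_rat (snd p)"
    then obtain y q where yq: "(y, q) \<in> P" "L h * d \<xi> (T' h y) < of_rat q"
      by auto
    then have "d y (T h \<xi>) < of_rat q"
      using T_upper[of h \<xi> "T' h y"] by (simp add: T_inverse commute)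
    then show "T h \<xi> \<in> U"
      using yq by (auto simp: P_def)
  next
    assume "T h \<xi> \<in> U"
    then obtain r where r: "r > 0" "mball (T h \<xi>) r \<subseteq> U"
      using U by (auto simp: open_iff_mball)
    \<comment> \<open>The first bound keeps the ball around \<open>y\<close> inside the ball of
      radius \<open>r\<close>; the second compensates the factor \<open>L h / l h\<close> lost by
      testing through \<open>T' h y\<close>.\<close>
    define e where "e = min (r / 2) (l h / L h * (r / 2))"
    have e: "e > 0"
      using r l_pos[of h] L_pos[of h] by (simp add: e_def)
    obtain y where y: "y \<in> D" "d (T h \<xi>) y < e"
      using dense_D[OF e] by blast
    have "L h * d \<xi> (T' h y) \<le> L h / l h * d (T h \<xi>) y"
      using T_lower[of h \<xi> "T' h y"] l_pos[of h] L_pos[of h] by (simp add: T_inverse field_simps)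
    also have "\<dots> < L h / l h * (l h / L h * (r / 2))"
      using y l_pos[of h] L_pos[of h] by (intro mult_strict_left_mono) (auto simp: e_def)
    also have "\<dots> = r / 2"
      using l_pos[of h] L_pos[of h] by simp
    finally obtain q :: rat where q: "L h * d \<xi> (T' h y) < of_rat q" "of_rat q < r / 2"
      using of_rat_dense by blast
    have "mball y (of_rat q) \<subseteq> mball (T h \<xi>) r"
    proof
      fix z assume "z \<in> mball y (of_rat q)"
      then show "z \<in> mball (T h \<xi>) r"
        using triangle[of "T h \<xi>" y z] y q by (simp add: e_def)
    qed
    then have "(y, q) \<in> P"
      using r y by (auto simp: P_def)
    then show "\<exists>p\<in>P. L h * d \<xi> (T' h (fst p)) < of_rat (snd p)"
      using q by force
  qed
  have "(\<lambda>p. T (snd p) (fst p)) -` U \<inter> space (\<nu> \<Otimes>\<^sub>M \<sigma>) =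
      (\<Union>p\<in>P. {z \<in> space (\<nu> \<Otimes>\<^sub>M \<sigma>). L (snd z) * d (fst z) (T' (snd z) (fst p)) < of_rat (snd p)})"
    using test by fastforce
  also have "\<dots> \<in> sets (\<nu> \<Otimes>\<^sub>M \<sigma>)"
    by (intro sets.countable_UN'' cP) measurable
  finally show "(\<lambda>p. T (snd p) (fst p)) -` U \<inter> space (\<nu> \<Otimes>\<^sub>M \<sigma>) \<in> sets (\<nu> \<Otimes>\<^sub>M \<sigma>)" .
qed

lemma T_measurable_section: "T h \<in> borel_measurable \<nu>"
  using measurable_compose[OF measurable_Pair2' T_measurable, of h] by (simp add: space_\<sigma>)

section \<open>The image of Haar measure under the dual action\<close>

lemma T_vimage_translate: "T h -` ((+) a ` A) = (+) (T' h a) ` (T h -` A)"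
proof safe
  fix \<xi> x assume x: "x \<in> A" "T h \<xi> = a + x"
  have "T h (\<xi> - T' h a) = x"
    using x by (simp add: dual_automorphism_diff automorphism T_inverse)
  then show "\<xi> \<in> (+) (T' h a) ` (T h -` A)"
    using x by (intro image_eqI[of _ _ "\<xi> - T' h a"]) auto
qed (auto simp: dual_automorphism_add automorphism T_inverse)

text \<open>The lower Lipschitz bound puts preimages of balls into balls, which gives finiteness;
  preimages of translates are translates of preimages, which gives invariance.\<close>

lemma haar_measure_distr_T:
  shows "haar_measure (distr \<nu> borel (T h))"
    and "emeasure (distr \<nu> borel (T h)) (mball 0 r) < \<infinity>"
proof -
  have fin: "emeasure (distr \<nu> borel (T h)) (mball 0 r) < \<infinity>" for r
  proof -
    have "T h -` mball 0 r \<subseteq> mball 0 (r / l h)"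
    proof
      fix \<xi> assume "\<xi> \<in> T h -` mball 0 r"
      moreover have "T h 0 = 0"
        using dual_automorphism_diff[OF automorphism, of h 0 0] by simp
      ultimately show "\<xi> \<in> mball 0 (r / l h)"
        using T_lower[of h 0 \<xi>] l_pos[of h] by (simp add: field_simps)
    qed
    then have "emeasure \<nu> (T h -` mball 0 r) \<le> emeasure \<nu> (mball 0 (r / l h))"
      by (intro emeasure_mono) (auto simp: sets_\<nu>)
    then show ?thesis
      using finite_mball[of 0 "r / l h"]
      by (simp add: emeasure_distr T_measurable_section space_\<nu>)
  qed
  then show "emeasure (distr \<nu> borel (T h)) (mball 0 r) < \<infinity>" .
  show "haar_measure (distr \<nu> borel (T h))"
    unfolding haar_measure_def
  proof (intro conjI allI impI ballI)
    show "emeasure (distr \<nu> borel (T h)) UNIV \<noteq> 0"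
      using haar_\<nu> by (simp add: emeasure_distr T_measurable_section space_\<nu> haar_measure_def)
    show "emeasure (distr \<nu> borel (T h)) K < \<infinity>" if "compact K" for K
    proof -
      have "mbounded K"
        using that by (intro compactin_imp_mbounded) (simp add: mtopology_eq)
      then obtain x B where B: "K \<subseteq> mcball x B"
        by (auto simp: mbounded_def)
      have "y \<in> mball 0 (d 0 x + B + 1)" if "y \<in> K" for y
        using that B triangle[of 0 x y] by (force simp: subset_iff)
      then have "emeasure (distr \<nu> borel (T h)) K \<le> emeasure (distr \<nu> borel (T h)) (mball 0 (d 0 x + B + 1))"
        by (intro emeasure_mono) auto
      then show ?thesis
        using fin[of "d 0 x + B + 1"] by (rule order.strict_trans1)
    qed
    show "emeasure (distr \<nu> borel (T h)) ((+) a ` A) = emeasure (distr \<nu> borel (T h)) A"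
      if A: "A \<in> sets borel" for a A
    proof -
      have image: "(+) a ` A = (+) (- a) -` A"
        by (force simp: image_iff)
      have "(+) (- a) \<in> borel_measurable borel"
        by (intro measurable_add) simp_all
      then have "(+) a ` A \<in> sets borel"
        unfolding image using measurable_sets[OF _ A] by (metis Int_UNIV_right space_borel)
      moreover have "T h -` A \<in> sets borel"
        using measurable_sets[OF T_measurable_section A, of h] by (simp add: space_\<nu> sets_\<nu>)
      ultimately show ?thesis
        using haar_\<nu> A
        by (simp add: emeasure_distr T_measurable_section space_\<nu> haar_measure_def T_vimage_translate)
    qed
  qed simp
qed

section \<open>The scaling constant from Plancherel\<close>

lemma plancherel_nn:
  assumes "integrable \<mu> g" "square_integrable \<mu> g"
  shows "fourier \<mu> g \<in> borel_measurable \<nu>"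
    and "(\<integral>\<^sup>+ \<xi>. ennreal ((norm (fourier \<mu> g \<xi>))\<^sup>2) \<partial>\<nu>) = ennreal (LINT x|\<mu>. (norm (g x))\<^sup>2)"
proof -
  have *: "square_integrable \<nu> (fourier \<mu> g)"
    "(LINT \<xi>|\<nu>. (norm (fourier \<mu> g \<xi>))\<^sup>2) = (LINT x|\<mu>. (norm (g x))\<^sup>2)"
    using plancherel assms by (auto simp: plancherel_measure_def)
  then show "fourier \<mu> g \<in> borel_measurable \<nu>"
    by (simp add: square_integrable_def)
  show "(\<integral>\<^sup>+ \<xi>. ennreal ((norm (fourier \<mu> g \<xi>))\<^sup>2) \<partial>\<nu>) = ennreal (LINT x|\<mu>. (norm (g x))\<^sup>2)"
    using * by (simp add: square_integrable_def nn_integral_eq_integral)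
qed

text \<open>The character \<open>T h \<xi>\<close> takes at \<open>\<alpha> h x\<close> the value of
  \<open>\<xi>\<close> at \<open>x\<close>. The integrand is therefore a function composed with
  \<open>\<alpha> h\<close>, and the modulus factors out.\<close>

lemma fourier_comp_\<alpha>:
  assumes "integrable \<mu> g"
  shows "fourier \<mu> (\<lambda>x. g (\<alpha> h x)) \<xi> = of_real (\<delta> h) * fourier \<mu> g (T h \<xi>)"
proof -
  have meas: "(\<lambda>x. cnj (pairing (T h \<xi>) x)) \<in> borel_measurable \<mu>"
    using borel_measurable_continuous_onI[OF continuous_on_cnj[OF continuous_on_pairing]]
    by (simp add: sets_\<mu> cong: measurable_cong_sets)
  have "integrable \<mu> (\<lambda>x. g x * cnj (pairing (T h \<xi>) x))"
    by (rule Bochner_Integration.integrable_bound[OF assms])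
      (use meas assms in \<open>auto simp: norm_mult\<close>)
  then have "(LINT x|\<mu>. g (\<alpha> h x) * cnj (pairing (T h \<xi>) (\<alpha> h x))) = of_real (\<delta> h) * fourier \<mu> g (T h \<xi>)"
    using modulus unfolding modulus_def fourier_def by blast
  moreover have "pairing (T h \<xi>) (\<alpha> h x) = pairing \<xi> x" for x
    using automorphism[of h] by (simp add: pairing_dual_automorphism is_automorphism_def bij_is_inj)
  ultimately show ?thesis
    by (simp add: fourier_def)
qed

text \<open>By uniqueness the image measure is proportional to \<open>\<nu>\<close>. Testing on
  \<open>G\<close>, the squared modulus of the transform of an indicator, fixes the factor:
  composing with \<open>\<alpha> h\<close> multiplies the transform by \<open>\<delta> h\<close>,
  hence its square by \<open>(\<delta> h)\<^sup>2\<close>, but the squared norm only by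
  \<open>\<delta> h\<close>.\<close>

lemma nn_integral_T:
  assumes g: "g \<in> borel_measurable borel"
  shows "ennreal (\<delta> h) * (\<integral>\<^sup>+ \<xi>. g (T h \<xi>) \<partial>\<nu>) = (\<integral>\<^sup>+ \<xi>. g \<xi> \<partial>\<nu>)"
proof -
  let ?N = "distr \<nu> borel (T h)"
  obtain K where K: "compact K" "0 < emeasure \<mu> K" "emeasure \<mu> K < \<infinity>"
    using haar_measure_compact_pos[OF locally_compact haar] by blast
  have K_sets: "K \<in> sets \<mu>"
    using K by (simp add: sets_\<mu> compact_imp_closed)
  define k :: "'g \<Rightarrow> complex" where "k = (\<lambda>x. of_real (indicator K x))"
  have k2: "(norm (k x))\<^sup>2 = indicator K x" for x
    by (simp add: k_def indicator_def)
  have k_int: "integrable \<mu> k"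
    using K K_sets by (simp add: k_def)
  have k_meas: "k \<in> borel_measurable borel"
    using K_sets by (simp add: k_def sets_\<mu>)
  have k_L2: "square_integrable \<mu> k"
    using K K_sets k_int by (auto simp: square_integrable_def k2)
  define m where "m = measure \<mu> K"
  have m: "m > 0"
    using K by (simp add: m_def measure_def enn2real_positive_iff)
  have LINT_k: "(LINT x|\<mu>. k x) = of_real m"
    using K K_sets by (simp add: k_def m_def)
  have LINT_k\<alpha>: "(LINT x|\<mu>. k (\<alpha> h x)) = of_real (\<delta> h * m)"
    using modulus k_int LINT_k by (simp add: modulus_def)
  \<comment> \<open>A non-integrable function has Bochner integral 0, so the nonzero value just
    computed forces integrability.\<close>
  then have k\<alpha>_int: "integrable \<mu> (\<lambda>x. k (\<alpha> h x))"
    using not_integrable_integral_eq[of \<mu> "\<lambda>x. k (\<alpha> h x)"] m \<delta>_pos[of h] by fastforce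
  \<comment> \<open>As \<open>k\<close> takes only the values 0 and 1, its squared norm after
    composition is the integral already known from the modulus.\<close>
  have re: "(norm (k (\<alpha> h x)))\<^sup>2 = Re (k (\<alpha> h x))" for x
    by (simp add: k_def indicator_def)
  have k\<alpha>_L2: "square_integrable \<mu> (\<lambda>x. k (\<alpha> h x))"
    using k\<alpha>_int by (auto simp: square_integrable_def re)
  define G where "G = (\<lambda>\<xi>. ennreal ((norm (fourier \<mu> k \<xi>))\<^sup>2))"
  have G_meas: "G \<in> borel_measurable borel"
    using plancherel_nn(1)[OF k_int k_L2] unfolding G_def by (simp cong: measurable_cong_sets add: sets_\<nu>)
  have G1: "(\<integral>\<^sup>+ \<xi>. G \<xi> \<partial>\<nu>) = ennreal m"
    using K K_sets unfolding G_def plancherel_nn(2)[OF k_int k_L2] by (simp add: k2 m_def)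
  have G_T: "ennreal ((norm (fourier \<mu> (\<lambda>x. k (\<alpha> h x)) \<xi>))\<^sup>2) = ennreal ((\<delta> h)\<^sup>2) * G (T h \<xi>)" for \<xi>
    by (simp add: G_def fourier_comp_\<alpha>[OF k_int] norm_mult power_mult_distrib ennreal_mult)
  have G_N: "(\<integral>\<^sup>+ \<xi>. G \<xi> \<partial>?N) = (\<integral>\<^sup>+ \<xi>. G (T h \<xi>) \<partial>\<nu>)"
    using G_meas by (simp add: nn_integral_distr T_measurable_section)
  have "ennreal ((\<delta> h)\<^sup>2) * (\<integral>\<^sup>+ \<xi>. G (T h \<xi>) \<partial>\<nu>)
      = (\<integral>\<^sup>+ \<xi>. ennreal ((norm (fourier \<mu> (\<lambda>x. k (\<alpha> h x)) \<xi>))\<^sup>2) \<partial>\<nu>)"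
    using measurable_compose[OF T_measurable_section G_meas] by (simp add: G_T nn_integral_cmult)
  also have "\<dots> = ennreal (LINT x|\<mu>. Re (k (\<alpha> h x)))"
    unfolding plancherel_nn(2)[OF k\<alpha>_int k\<alpha>_L2] re ..
  also have "\<dots> = ennreal (\<delta> h * m)"
    using LINT_k\<alpha> k\<alpha>_int by simp
  finally have "ennreal (\<delta> h) * (ennreal (\<delta> h) * (\<integral>\<^sup>+ \<xi>. G \<xi> \<partial>?N)) = ennreal (\<delta> h) * ennreal m"
    using \<delta>_pos[of h] m by (simp add: G_N power2_eq_square ennreal_mult mult.assoc)
  then have G2: "ennreal (\<delta> h) * (\<integral>\<^sup>+ \<xi>. G \<xi> \<partial>?N) = ennreal m"
    using \<delta>_pos[of h] by (simp add: ennreal_mult_cancel_left)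
  let ?a = "emeasure ?N (mball 0 1)" and ?b = "emeasure \<nu> (mball 0 1)"
  have unique: "?a * (\<integral>\<^sup>+ \<xi>. u \<xi> \<partial>\<nu>) = ?b * (\<integral>\<^sup>+ \<xi>. u \<xi> \<partial>?N)" if "u \<in> borel_measurable borel" for u
    by (rule haar_measure_unique) (use haar_measure_distr_T haar_\<nu> finite_mball that in auto)
  \<comment> \<open>Uniqueness applied to \<open>G\<close> transfers the factor found there to the
    unit ball, whose measures are the constants in the uniqueness statement.\<close>
  have "ennreal m * (ennreal (\<delta> h) * ?a) = ennreal (\<delta> h) * (?a * (\<integral>\<^sup>+ \<xi>. G \<xi> \<partial>\<nu>))"
    by (simp add: G1 mult_ac)
  also have "\<dots> = ?b * (ennreal (\<delta> h) * (\<integral>\<^sup>+ \<xi>. G \<xi> \<partial>?N))"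
    unfolding unique[OF G_meas] by (simp add: mult_ac)
  also have "\<dots> = ennreal m * ?b"
    by (simp add: G2 mult_ac)
  finally have ab: "ennreal (\<delta> h) * ?a = ?b"
    using m by (simp add: ennreal_mult_cancel_left)
  have "?a * (ennreal (\<delta> h) * (\<integral>\<^sup>+ \<xi>. g \<xi> \<partial>?N)) = ?b * (\<integral>\<^sup>+ \<xi>. g \<xi> \<partial>?N)"
    unfolding ab[symmetric] by (simp add: mult_ac)
  also have "\<dots> = ?a * (\<integral>\<^sup>+ \<xi>. g \<xi> \<partial>\<nu>)"
    using unique[OF g] ..
  \<comment> \<open>Cancellation in the extended reals requires the ball to have positive and finite
    measure.\<close>
  moreover have "?a \<noteq> 0" "?a \<noteq> top"
    using haar_measure_mball_pos[OF haar_measure_distr_T(1), of 1 h] haar_measure_distr_T(2)[of h 1] by auto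
  ultimately have "ennreal (\<delta> h) * (\<integral>\<^sup>+ \<xi>. g \<xi> \<partial>?N) = (\<integral>\<^sup>+ \<xi>. g \<xi> \<partial>\<nu>)"
    by (simp add: ennreal_mult_cancel_left)
  then show ?thesis
    using g by (simp add: nn_integral_distr T_measurable_section)
qed

end

subsection \<open>Local integrability\<close>

text \<open>The essential bound fails only on a null set, which cannot contain an interval of
  positive length. It therefore holds at points arbitrarily close to any given one.\<close>

lemma in_Linfty_dense_bound:
  assumes "in_Linfty {M..} u"
  obtains K where "K < \<infinity>" "\<And>a b. M \<le> a \<Longrightarrow> a < b \<Longrightarrow> \<exists>t. a < t \<and> t < b \<and> u t \<le> K"
proof (rule that)
  let ?K = "esssup (lebesgue_on {M..}) u"
  show "?K < \<infinity>"
    using assms by (simp add: in_Linfty_def)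
  show "\<exists>t. a < t \<and> t < b \<and> u t \<le> ?K" if ab: "M \<le> a" "a < b" for a b
  proof (rule ccontr)
    assume none: "\<not> ?thesis"
    have "AE t in lebesgue. t \<in> {M..} \<longrightarrow> u t \<le> ?K"
      using esssup_AE[of u "lebesgue_on {M..}"] by (subst (asm) AE_restrict_space_iff) auto
    then have "AE t in lebesgue. t \<notin> {a<..<b}"
      by eventually_elim (use none ab in force)
    then have "emeasure lebesgue {t \<in> space lebesgue. \<not> t \<notin> {a<..<b}} = 0"
      by (subst (asm) AE_iff_measurable[OF _ refl]) auto
    moreover have "emeasure lebesgue {a<..<b} = ennreal (b - a)"
      using ab by simp
    moreover have "{t \<in> space lebesgue. \<not> t \<notin> {a<..<b}} = {a<..<b}"
      by auto
    ultimately show False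
      using ab by (metis diff_gt_0_iff_gt ennreal_eq_zero_iff less_irrefl less_le_not_le)
  qed
qed

context bilipschitz_dual_action
begin

text \<open>Below \<open>M\<close> the condition \<open>l h \<le> 3 * t\<close> forces \<open>L h \<le> f (3 * M)\<close>, so the set is empty. Above \<open>M\<close>
  the essential bound need not hold at \<open>t\<close> itself; it holds at some \<open>s\<close> slightly below \<open>t\<close>, and
  passing from \<open>t\<close> to \<open>s\<close> costs the enlargement of the factor from \<open>3\<close> to \<open>4\<close>.\<close>

lemma level_set_bound:
  assumes f: "mono_on {0<..} f" and M: "M > 0"
    and expanding: "\<And>h. L h > M0 \<Longrightarrow> L h \<le> f (l h)"
    and bound: "in_Linfty {M..} (\<lambda>t. emeasure \<sigma> {h. t \<le> L h \<and> L h \<le> f (4 * t)})"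
  obtains K where "K < \<infinity>"
    "\<And>t. emeasure \<sigma> {h. max M0 (f (3 * M)) < L h \<and> t \<le> L h \<and> l h \<le> 3 * t} \<le> K"
proof -
  obtain K where K: "K < \<infinity>" "\<And>a b. M \<le> a \<Longrightarrow> a < b \<Longrightarrow>
      \<exists>t. a < t \<and> t < b \<and> emeasure \<sigma> {h. t \<le> L h \<and> L h \<le> f (4 * t)} \<le> K"
    using in_Linfty_dense_bound[OF bound] by metis
  have L_le: "L h \<le> f (3 * r)" if "M0 < L h" "l h \<le> 3 * r" for h r
  proof -
    have "f (l h) \<le> f (3 * r)"
      using l_pos[of h] that by (intro mono_onD[OF f]) auto
    then show ?thesis
      using expanding[OF that(1)] by simp
  qed
  show ?thesis
  proof (rule that)
    show "K < \<infinity>" by fact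
    fix t
    let ?A = "{h. max M0 (f (3 * M)) < L h \<and> t \<le> L h \<and> l h \<le> 3 * t}"
    show "emeasure \<sigma> ?A \<le> K"
    proof (cases "t \<le> M")
      case True
      have "?A = {}"
        using L_le[of _ M] True by fastforce
      then show ?thesis
        by (metis emeasure_empty zero_le)
    next
      case False
      \<comment> \<open>The threshold \<open>3 * t / 4\<close> is what makes \<open>3 * t\<close>
        smaller than \<open>4 * s\<close>, so that monotonicity of \<open>f\<close> applies.\<close>
      obtain s where s: "max M (3 * t / 4) < s" "s < t"
          "emeasure \<sigma> {h. s \<le> L h \<and> L h \<le> f (4 * s)} \<le> K"
        using K(2)[of "max M (3 * t / 4)" t] False M by auto
      have "f (3 * t) \<le> f (4 * s)"
        using s False M by (intro mono_onD[OF f]) auto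
      then have "?A \<subseteq> {h. s \<le> L h \<and> L h \<le> f (4 * s)}"
        using L_le[of _ t] s by force
      moreover have "{h \<in> space \<sigma>. s \<le> L h \<and> L h \<le> f (4 * s)} \<in> sets \<sigma>"
        by measurable
      ultimately show ?thesis
        using s(3) by (simp add: space_\<sigma>) (meson emeasure_mono order.trans)
    qed
  qed
qed

text \<open>The bound \<open>K\<close> on the weight does not refer to \<open>F\<close>, so the same
  threshold \<open>M'\<close> serves every representative of the Fourier transform.\<close>

lemma orbit_integral_in_L1_loc:
  assumes F: "square_integrable \<nu> F"
    and K: "K < \<infinity>" "\<And>t. emeasure \<sigma> {h. M' < L h \<and> t \<le> L h \<and> l h \<le> 3 * t} \<le> K"
  shows "in_L1_loc \<nu> d (UNIV - {0})
    (\<lambda>\<xi>. \<integral>\<^sup>+ h \<in> {h. L h > M'}. ennreal ((norm (D_hat \<alpha> \<delta> h F \<xi>))\<^sup>2) \<partial>\<sigma>)"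
proof -
  define G where "G = (\<lambda>\<eta>. ennreal ((norm (F \<eta>))\<^sup>2))"
  have F_meas [measurable]: "F \<in> borel_measurable borel"
    using F by (simp add: square_integrable_def sets_\<nu> cong: measurable_cong_sets)
  have G_meas [measurable]: "G \<in> borel_measurable borel"
    by (simp add: G_def)
  have G_fin: "(\<integral>\<^sup>+ \<eta>. G \<eta> \<partial>\<nu>) < \<infinity>"
    using F by (simp add: square_integrable_def G_def nn_integral_eq_integral)
  have GT_meas [measurable]: "(\<lambda>p. G (T (snd p) (fst p))) \<in> borel_measurable (\<nu> \<Otimes>\<^sub>M \<sigma>)"
    by (rule measurable_compose[OF T_measurable G_meas])
  have D_hat: "ennreal ((norm (D_hat \<alpha> \<delta> h F \<xi>))\<^sup>2) = ennreal (\<delta> h) * G (T h \<xi>)" for h \<xi>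
    using \<delta>_pos[of h] by (simp add: D_hat_def G_def norm_mult power_mult_distrib ennreal_mult)
  have ind_L [measurable]: "indicator {h. L h > M'} \<in> borel_measurable \<sigma>"
  proof (rule borel_measurable_indicator)
    have "{h \<in> space \<sigma>. L h > M'} \<in> sets \<sigma>"
      by measurable
    then show "{h. L h > M'} \<in> sets \<sigma>"
      by (simp add: space_\<sigma>)
  qed
  define W where "W h \<xi> = ennreal (\<delta> h) * G (T h \<xi>) * indicator {h. L h > M'} h" for h \<xi>
  have W_meas: "(\<lambda>(\<xi>, h). W h \<xi>) \<in> borel_measurable (\<nu> \<Otimes>\<^sub>M \<sigma>)"
    unfolding W_def case_prod_beta by measurable
  show ?thesis
    unfolding in_L1_loc_def D_hat W_def[symmetric]
  proof (intro conjI ballI)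
    show "(\<lambda>\<xi>. \<integral>\<^sup>+ h. W h \<xi> \<partial>\<sigma>) \<in> borel_measurable \<nu>"
      by (rule sH.borel_measurable_nn_integral[OF W_meas])
    fix \<xi>0 :: "'g pontryagin_dual" assume "\<xi>0 \<in> UNIV - {0}"
    define R where "R = d \<xi>0 0"
    have R: "R > 0"
      using \<open>\<xi>0 \<in> _\<close> by (simp add: R_def)
    define B where "B = mball \<xi>0 (R / 2)"
    \<comment> \<open>A condition that holds whenever \<open>\<eta>\<close> lies in the image of
      \<open>B\<close> under \<open>T h\<close> and \<open>L h > M'\<close>. Points of
      \<open>B\<close> have distance between \<open>R / 2\<close> and \<open>3 * R / 2\<close> from
      0: the larger value yields the lower bound on \<open>L h\<close>, the smaller one the upper
      bound \<open>2 * d \<eta> 0 / R\<close> on \<open>l h\<close>.\<close>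
    define E where "E h \<eta> \<longleftrightarrow>
        M' < L h \<and> 2 * d \<eta> 0 / (3 * R) \<le> L h \<and> l h \<le> 3 * (2 * d \<eta> 0 / (3 * R))" for h \<eta>
    have E_meas [measurable]: "Measurable.pred (\<nu> \<Otimes>\<^sub>M \<sigma>) (\<lambda>p. E (snd p) (fst p))"
      unfolding E_def by measurable
    have E_sec: "Measurable.pred borel (E h)" for h
      unfolding E_def by measurable
    have E_orbit: "E h (T h \<xi>)" if "\<xi> \<in> B" "L h > M'" for h \<xi>
    proof -
      have "T h 0 = 0"
        using dual_automorphism_diff[OF automorphism, of h 0 0] by simp
      then have bounds: "l h * d \<xi> 0 \<le> d (T h \<xi>) 0" "d (T h \<xi>) 0 \<le> L h * d \<xi> 0"
        using T_lower[of h \<xi> 0] T_upper[of h \<xi> 0] by auto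
      have "R / 2 \<le> d \<xi> 0" "d \<xi> 0 \<le> 3 * R / 2"
        using that(1) triangle[of \<xi>0 \<xi> 0] triangle[of \<xi> \<xi>0 0] by (auto simp: B_def R_def commute)
      then have "l h * (R / 2) \<le> l h * d \<xi> 0" "L h * d \<xi> 0 \<le> L h * (3 * R / 2)"
        using l_pos[of h] L_pos[of h] by (auto intro!: mult_left_mono)
      then have "l h * (R / 2) \<le> d (T h \<xi>) 0" "d (T h \<xi>) 0 \<le> L h * (3 * R / 2)"
        using bounds by linarith+
      then show ?thesis
        using that(2) R by (simp add: E_def field_simps)
    qed
    define V where "V h \<eta> = G \<eta> * indicator {p. E (snd p) (fst p)} (\<eta>, h)" for h \<eta>
    have V_meas: "(\<lambda>(\<eta>, h). V h \<eta>) \<in> borel_measurable (\<nu> \<Otimes>\<^sub>M \<sigma>)"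
      unfolding V_def case_prod_beta by measurable
    have V_sec: "V h \<in> borel_measurable borel" for h
    proof -
      have "{\<eta>. E h \<eta>} \<in> sets borel"
        using E_sec[of h] by (simp add: pred_def)
      moreover have "V h = (\<lambda>\<eta>. G \<eta> * indicator {\<eta>. E h \<eta>} \<eta>)"
        by (auto simp: V_def fun_eq_iff indicator_def)
      ultimately show ?thesis
        by simp
    qed
    have WB_meas: "(\<lambda>(\<xi>, h). W h \<xi> * indicator B \<xi>) \<in> borel_measurable (\<nu> \<Otimes>\<^sub>M \<sigma>)"
      using W_meas unfolding B_def case_prod_beta by measurable
    have "(\<integral>\<^sup>+ \<xi> \<in> B. (\<integral>\<^sup>+ h. W h \<xi> \<partial>\<sigma>) \<partial>\<nu>) = (\<integral>\<^sup>+ \<xi>. (\<integral>\<^sup>+ h. W h \<xi> * indicator B \<xi> \<partial>\<sigma>) \<partial>\<nu>)"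
      using measurable_Pair2[OF W_meas] by (intro nn_integral_cong) (simp add: nn_integral_multc space_\<nu>)
    also have "\<dots> = (\<integral>\<^sup>+ h. (\<integral>\<^sup>+ \<xi>. W h \<xi> * indicator B \<xi> \<partial>\<nu>) \<partial>\<sigma>)"
      using NH.Fubini'[OF WB_meas] ..
    \<comment> \<open>The restriction of \<open>\<xi>\<close> to \<open>B\<close> is traded for a
      condition on \<open>T h \<xi>\<close>, so that the integrand becomes a function of the new
      variable.\<close>
    also have "\<dots> \<le> (\<integral>\<^sup>+ h. (\<integral>\<^sup>+ \<xi>. ennreal (\<delta> h) * V h (T h \<xi>) \<partial>\<nu>) \<partial>\<sigma>)"
      using E_orbit by (intro nn_integral_mono) (auto simp: W_def V_def indicator_def)
    \<comment> \<open>The Jacobian of the substitution cancels the factor \<open>\<delta> h\<close>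
      coming from \<open>D_hat\<close>.\<close>
    also have "\<dots> = (\<integral>\<^sup>+ h. (\<integral>\<^sup>+ \<eta>. V h \<eta> \<partial>\<nu>) \<partial>\<sigma>)"
      using measurable_compose[OF T_measurable_section V_sec]
      by (simp add: nn_integral_cmult nn_integral_T[OF V_sec])
    also have "\<dots> = (\<integral>\<^sup>+ \<eta>. (\<integral>\<^sup>+ h. V h \<eta> \<partial>\<sigma>) \<partial>\<nu>)"
      using NH.Fubini'[OF V_meas] .
    \<comment> \<open>For fixed \<open>\<eta>\<close> the remaining \<open>h\<close>-integral
      measures the level set with \<open>t = 2 * d \<eta> 0 / (3 * R)\<close>.\<close>
    also have "\<dots> \<le> (\<integral>\<^sup>+ \<eta>. G \<eta> * K \<partial>\<nu>)"
    proof (rule nn_integral_mono)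
      fix \<eta>
      have sets_E: "{h. E h \<eta>} \<in> sets \<sigma>"
      proof -
        have "{h \<in> space \<sigma>. E h \<eta>} \<in> sets \<sigma>"
          unfolding E_def by measurable
        then show ?thesis
          by (simp add: space_\<sigma>)
      qed
      have "(\<integral>\<^sup>+ h. V h \<eta> \<partial>\<sigma>) = (\<integral>\<^sup>+ h. G \<eta> * indicator {h. E h \<eta>} h \<partial>\<sigma>)"
        by (intro nn_integral_cong) (simp add: V_def indicator_def)
      also have "\<dots> = G \<eta> * emeasure \<sigma> {h. E h \<eta>}"
        using sets_E by (rule nn_integral_cmult_indicator)
      also have "\<dots> \<le> G \<eta> * K"
        using K(2)[of "2 * d \<eta> 0 / (3 * R)"] unfolding E_def by (intro mult_left_mono) auto
      finally show "(\<integral>\<^sup>+ h. V h \<eta> \<partial>\<sigma>) \<le> G \<eta> * K" .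
    qed
    also have "\<dots> = (\<integral>\<^sup>+ \<eta>. G \<eta> \<partial>\<nu>) * K"
      by (rule nn_integral_multc) (simp cong: measurable_cong_sets add: sets_\<nu>)
    also have "\<dots> < \<infinity>"
      using G_fin K(1) by (simp add: ennreal_mult_less_top)
    finally show "\<exists>\<epsilon>>0. (\<integral>\<^sup>+ \<xi> \<in> mball \<xi>0 \<epsilon>. (\<integral>\<^sup>+ h. W h \<xi> \<partial>\<sigma>) \<partial>\<nu>) < \<infinity>"
      using R by (intro exI[of _ "R / 2"]) (simp add: B_def)
  qed
qed

end

section \<open>Choice of the threshold and conclusion\<close>

theorem theorem22:
  fixes \<mu> :: "'g::{topological_ab_group_add, second_countable_topology, t2_space} measure"
    and \<nu> :: "'g pontryagin_dual measure"
    and d :: "'g pontryagin_dual \<Rightarrow> 'g pontryagin_dual \<Rightarrow> real"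
    and \<sigma> :: "'h::topological_space measure"
    and \<alpha> :: "'h \<Rightarrow> 'g \<Rightarrow> 'g"
    and \<delta> l L :: "'h \<Rightarrow> real"
    and f :: "real \<Rightarrow> real"
  assumes "locally_compact_space (euclidean :: 'g topology)"
    and "haar_measure \<mu>"
    and "plancherel_measure \<mu> \<nu>"
    and "invariant_proper_metric d"
    and "weakly_doubling \<nu> d"
    and "sets \<sigma> = sets borel" and "sigma_finite_measure \<sigma>"
    and "\<And>h. is_automorphism (\<alpha> h)"
    and "(\<lambda>(x, h). \<alpha> h x) \<in> \<mu> \<Otimes>\<^sub>M \<sigma> \<rightarrow>\<^sub>M borel"
    and "modulus \<mu> \<sigma> \<alpha> \<delta>"
    and "uniformly_expanding \<sigma> d (\<lambda>h. dual_automorphism (\<alpha> h)) l L f"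
    and "\<exists>M > 0. \<forall>c > 1.
           in_Linfty {M..} (\<lambda>t. emeasure \<sigma> {h. t \<le> L h \<and> L h \<le> f (c * t)})"
  shows "\<forall>\<psi>. square_integrable \<mu> \<psi> \<longrightarrow>
           (\<exists>M' > 0. \<forall>\<psi>_hat. fourier_L2 \<mu> \<nu> \<psi> \<psi>_hat \<longrightarrow>
              in_L1_loc \<nu> d (UNIV - {0})
                (\<lambda>\<xi>. \<integral>\<^sup>+ h \<in> {h. L h > M'}. ennreal ((norm (D_hat \<alpha> \<delta> h \<psi>_hat \<xi>))\<^sup>2) \<partial>\<sigma>))"
proof (intro allI impI)
  fix \<psi> :: "'g \<Rightarrow> complex"
  obtain D where "separable_metric_group d D"
    using separable_metric_group_if_proper[OF assms(4)] by blast
  then interpret separable_metric_group d D .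
  interpret sH: sigma_finite_measure \<sigma>
    by fact
  have expanding: "measurably_bilipschitz \<sigma> d (\<lambda>h. dual_automorphism (\<alpha> h)) l L"
      "mono_on {0<..} f" "\<exists>M > 0. \<forall>h. L h > M \<longrightarrow> L h \<le> f (l h)"
    using assms(11) by (auto simp: uniformly_expanding_def)
  interpret bilipschitz_dual_action d D \<sigma> \<mu> \<nu> \<alpha> \<delta> l L
    by unfold_locales
      (use assms expanding(1) sets_eq_imp_space_eq[OF assms(6)] in auto)
  obtain M0 where M0: "M0 > 0" "\<And>h. L h > M0 \<Longrightarrow> L h \<le> f (l h)"
    using expanding(3) by blast
  obtain M where M: "M > 0" "\<And>c. c > 1 \<Longrightarrow>
      in_Linfty {M..} (\<lambda>t. emeasure \<sigma> {h. t \<le> L h \<and> L h \<le> f (c * t)})"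
    using assms(12) by blast
  \<comment> \<open>The factor 4 is the one left after moving to a nearby good point in
    \<open>level_set_bound\<close>. The resulting threshold is positive because of \<open>M0\<close>
    and is fixed before any representative is chosen.\<close>
  obtain K where K: "K < \<infinity>"
      "\<And>t. emeasure \<sigma> {h. max M0 (f (3 * M)) < L h \<and> t \<le> L h \<and> l h \<le> 3 * t} \<le> K"
    using level_set_bound[OF expanding(2) M(1) M0(2) M(2)[of 4]] by auto
  have "\<forall>\<psi>_hat. fourier_L2 \<mu> \<nu> \<psi> \<psi>_hat \<longrightarrow> in_L1_loc \<nu> d (UNIV - {0})
      (\<lambda>\<xi>. \<integral>\<^sup>+ h \<in> {h. L h > max M0 (f (3 * M))}. ennreal ((norm (D_hat \<alpha> \<delta> h \<psi>_hat \<xi>))\<^sup>2) \<partial>\<sigma>)"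
    using orbit_integral_in_L1_loc[OF _ K] unfolding fourier_L2_def by blast
  then show "\<exists>M' > 0. \<forall>\<psi>_hat. fourier_L2 \<mu> \<nu> \<psi> \<psi>_hat \<longrightarrow> in_L1_loc \<nu> d (UNIV - {0})
      (\<lambda>\<xi>. \<integral>\<^sup>+ h \<in> {h. L h > M'}. ennreal ((norm (D_hat \<alpha> \<delta> h \<psi>_hat \<xi>))\<^sup>2) \<partial>\<sigma>)"
    using M0(1) by (intro exI[of _ "max M0 (f (3 * M))"]) auto
qed

end
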